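(* Fix an integer $d\ge 3$. For each $n$ under consideration let $G=G^{(n)}$ be an arbitrary $d$-regular graph on $n$ vertices, and let $\mathcal{C}_1(G_p)$ be the largest connected component of the random graph $G_p$ obtained by bond percolation on $G$ with probability $p$. For $\varepsilon>0$ put $\psi_n(\varepsilon)=2\varepsilon^{-2}\log(n\varepsilon^{3})$. 1. If $p=\frac{1-\varepsilon(n)}{d-1}$, where $\varepsilon(n)\ge 0$ is a sequence such that $\varepsilon(n)\to 0$ and $\varepsilon(n)n^{1/3}\to\infty$, then for any $\eta>0$ $$\mathbb{P}\Big(|\mathcal{C}_1(G_p)|>(1+\eta)\frac{d-2}{d-1}\,\psi_n(\varepsilon(n))\Big)\to 0\qquad\text{as } n\to\infty .$$ 2. If $p\le\frac{1}{d-1}$, then for any $A>1$ $$\mathbb{P}\big(|\mathcal{C}_1(G_p)|>An^{2/3}\big)\le\frac{8}{A^{3/2}} .$$ 3. There exists a constant $C>0$ (not depending on $n$, $G$ or $\varepsilon(n)$) such that if $p=\frac{1+\varepsilon(n)}{d-1}$ where $\varepsilon(n)>0$, then $$\mathbb{E}\,|\mathcal{C}_1(G_p)|\le C\big(n^{2/3}+\varepsilon(n)n\big).$$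
   Context: Bond percolation with probability $p\in(0,1)$ on a graph $G$: each edge of $G$ is independently retained with probability $p$ and deleted with probability $1-p$; the resulting random graph on the same vertex set is $G_p$. $|\mathcal{C}|$ denotes the number of vertices of a component $\mathcal{C}$. The integer $d$ is fixed and $n$ grows. *)

theory Defs
  imports "HOL-Probability.Probability"
begin

text \<open>A finite simple graph is given by its vertex set \<open>V\<close> and its edge set \<open>E\<close>, a set of
  two-element subsets of \<open>V\<close>. The null graph is excluded, since it has no component.\<close>

definition graph :: "'a set \<Rightarrow> 'a set set \<Rightarrow> bool" where
  "graph V E \<longleftrightarrow> finite V \<and> V \<noteq> {} \<and> E \<subseteq> {e. e \<subseteq> V \<and> card e = 2}"

definition degree :: "'a set set \<Rightarrow> 'a \<Rightarrow> nat" where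
  "degree E v = card {e \<in> E. v \<in> e}"

definition regular_graph :: "nat \<Rightarrow> 'a set \<Rightarrow> 'a set set \<Rightarrow> bool" where
  "regular_graph d V E \<longleftrightarrow> graph V E \<and> (\<forall>v\<in>V. degree E v = d)"

definition connected_rel :: "'a set \<Rightarrow> 'a set set \<Rightarrow> 'a rel" where
  "connected_rel V E = {(u, v). u \<in> V \<and> v \<in> V \<and> (u, v) \<in> {(x, y). {x, y} \<in> E}\<^sup>*}"

definition components :: "'a set \<Rightarrow> 'a set set \<Rightarrow> 'a set set" where
  "components V E = V // connected_rel V E"

text \<open>Ties between components of maximal size are broken arbitrarily; only the size matters below.\<close>

definition largest_component :: "'a set \<Rightarrow> 'a set set \<Rightarrow> 'a set" where
  "largest_component V E = (ARG_MAX card C. C \<in> components V E)"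

text \<open>The distribution of the retained edge set; the vertex set is unchanged by percolation.
  It is meaningful for finite \<open>E\<close> and \<open>p \<in> [0, 1]\<close> only.\<close>

definition percolation :: "'a set set \<Rightarrow> real \<Rightarrow> 'a set set pmf" where
  "percolation E p =
     map_pmf (\<lambda>\<omega>. {e \<in> E. \<omega> e}) (Pi_pmf E False (\<lambda>_. bernoulli_pmf p))"

definition \<psi> :: "nat \<Rightarrow> real \<Rightarrow> real" where
  "\<psi> n \<epsilon> = 2 / \<epsilon>\<^sup>2 * ln (real n * \<epsilon> ^ 3)"

end

theory Submission
  imports Defs
begin

text \<open>
  Write \<open>m = d - 1\<close> and let \<open>C(v)\<close> be the cluster of a vertex \<open>v\<close> in the percolated graph.
  Everything follows from bounds on \<open>P(|C(v)| \<ge> k)\<close>: a largest component with at least \<open>k\<close>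
  vertices consists of vertices whose clusters have size at least \<open>k\<close>, so with \<open>N\<close> the number of
  such vertices, Markov's inequality gives \<open>k P(|C\<^sub>1| \<ge> k) \<le> E N\<close>, and \<open>E |C\<^sub>1| \<le> k + E N\<close>, where
  \<open>E N \<le> n max P(|C(v)| \<ge> k)\<close>.

  Explored edge by edge, \<open>|C(v)|\<close> is dominated by the total progeny of a branching process with
  offspring law \<open>Bin(m, p)\<close>, except that the root has \<open>d\<close> potential children; an edge leading
  back to a vertex already found only helps. The domination is used in the form of an exponential
  submartingale: if \<open>w \<le> 1 - p + p z\<close> and \<open>z = t w\<^sup>m\<close>, then \<open>t\<close> to the number of vertices found times \<open>w\<close> to the number of unexplored edges
  at them does not decrease in mean along the exploration, whence \<open>E t^|C(v)| \<ge> t w\<^sup>d\<close>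
  (\<open>cluster_generating_function\<close>). This is proved by induction on the edge set
  (\<open>exploration_induct\<close>), without a stochastic process.

  Markov's inequality turns the bound into a tail estimate. At or below \<open>p = 1/m\<close>, taking
  \<open>z = 1 - 2/sqrt k\<close> gives \<open>P(|C(v)| \<ge> k) \<le> 6/sqrt k\<close>; at \<open>p = (1 + \<epsilon>)/m\<close>, taking
  \<open>z = 1 - 8\<epsilon> - 4/sqrt k\<close> gives \<open>32\<epsilon> + 16/sqrt k\<close>. With \<open>k\<close> of order \<open>n^(2/3)\<close> these are the second
  and the third claim.

  The first claim needs the sharp exponential rate together with a prefactor of order
  \<open>1/sqrt k\<close>. Both come from comparing the percolation at \<open>p = (1 - \<epsilon>)/m\<close> with the one at \<open>1/m\<close>.
  Finding \<open>k\<close> vertices takes \<open>k - 1\<close> open edges and at most about \<open>k (d - 2)\<close> closed ones, so the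
  likelihood ratio is at most a constant times \<open>((1 - \<epsilon>)(1 + \<epsilon>/(d - 2))^(d - 2))\<^sup>k\<close>
  (\<open>cluster_tail_comparison\<close>), and the base is \<open>exp(- \<epsilon>\<^sup>2 (d - 1)/(2 (d - 2)) + O(\<epsilon>\<^sup>3))\<close>. At the
  threshold \<open>k\<close> of the claim this ratio is \<open>(n \<epsilon>\<^sup>3)\<close> to the power \<open>-(1 + \<eta>)(1 - O(\<epsilon>))\<close>, while the
  critical bound contributes \<open>n/k^(3/2) \<le> n \<epsilon>\<^sup>3\<close>; since \<open>n \<epsilon>\<^sup>3 \<rightarrow> \<infinity>\<close>, the product tends to zero.
\<close>

section \<open>Clusters in a fixed graph\<close>

text \<open>Starting from a set of vertices rather than from one vertex makes revealing an open edge a change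
  of the starting set, which is what the induction over the exploration needs.\<close>

definition cluster :: "'a set set \<Rightarrow> 'a set \<Rightarrow> 'a set" where
  "cluster F A = {(x, y). {x, y} \<in> F}\<^sup>* `` A"

lemma subset_cluster: "A \<subseteq> cluster F A"
  by (auto simp: cluster_def)

lemma cluster_subset_closed:
  assumes "A \<subseteq> B" "\<And>x y. {x, y} \<in> F \<Longrightarrow> x \<in> B \<Longrightarrow> y \<in> B"
  shows "cluster F A \<subseteq> B"
proof
  fix v assume "v \<in> cluster F A"
  then obtain a where a: "a \<in> A" and "(a, v) \<in> {(x, y). {x, y} \<in> F}\<^sup>*"
    by (auto simp: cluster_def)
  from this(2) show "v \<in> B"
    by (induction rule: rtrancl_induct) (use a assms in auto)
qed

lemma cluster_step:
  assumes "x \<in> cluster F A" "{x, y} \<in> F"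
  shows "y \<in> cluster F A"
  using assms unfolding cluster_def by (auto intro: rtrancl_into_rtrancl)

lemma cluster_eq_self:
  assumes "\<And>e. e \<in> F \<Longrightarrow> e \<inter> A = {}"
  shows "cluster F A = A"
proof
  show "cluster F A \<subseteq> A" by (rule cluster_subset_closed) (use assms in fastforce)+
qed (rule subset_cluster)

text \<open>Revealing that an edge at a found vertex \<open>a\<close> is open amounts to declaring its other end \<open>b\<close> found
  and discarding the edge. For \<open>b \<in> A\<close> it says that an edge inside \<open>A\<close> does not change the
  cluster.\<close>

lemma cluster_insert_edge:
  assumes "a \<in> A"
  shows "cluster (insert {a, b} F) A = cluster F (insert b A)" (is "?L = ?R")
proof
  show "?L \<subseteq> ?R"
  proof (rule cluster_subset_closed)
    show "A \<subseteq> ?R" using subset_cluster[of "insert b A" F] by simp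
    fix x y assume xy: "{x, y} \<in> insert {a, b} F" "x \<in> ?R"
    show "y \<in> ?R"
    proof (cases "{x, y} = {a, b}")
      case True
      then have "y \<in> insert b A" using assms by (auto simp: doubleton_eq_iff)
      then show ?thesis using subset_cluster[of "insert b A" F] by (rule rev_subsetD)
    next
      case False
      then show ?thesis using xy cluster_step[of x F "insert b A" y] by simp
    qed
  qed
  show "?R \<subseteq> ?L"
  proof (rule cluster_subset_closed)
    have "b \<in> ?L"
      by (rule cluster_step[of a]) (use assms subset_cluster[of A] in auto)
    then show "insert b A \<subseteq> ?L" using subset_cluster[of A] by simp
    fix x y assume "{x, y} \<in> F" "x \<in> ?L"
    then show "y \<in> ?L" using cluster_step[of x "insert {a, b} F" A y] by simp
  qed
qed

lemma finite_cluster: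
  assumes "finite F" "\<And>e. e \<in> F \<Longrightarrow> card e = 2" "finite A"
  shows "finite (cluster F A)"
proof -
  have "cluster F A \<subseteq> A \<union> \<Union>F"
    by (rule cluster_subset_closed) auto
  moreover have "finite (A \<union> \<Union>F)"
    using assms by (intro finite_UnI finite_Union) (auto intro: card_ge_0_finite)
  ultimately show ?thesis by (rule finite_subset)
qed

lemma cluster_subset_vertices:
  assumes "graph V F" "v \<in> V"
  shows "cluster F {v} \<subseteq> V"
  using assms by (intro cluster_subset_closed) (auto simp: graph_def)

lemma cluster_eq_cluster:
  assumes "u \<in> cluster F {v}"
  shows "cluster F {u} = cluster F {v}"
proof -
  let ?R = "{(x, y). {x, y} \<in> F}"
  have "sym (?R\<^sup>*)"
    by (intro sym_rtrancl) (auto simp: sym_def insert_commute)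
  moreover have "(v, u) \<in> ?R\<^sup>*"
    using assms by (simp add: cluster_def)
  ultimately show ?thesis
    unfolding cluster_def by (auto dest: symD intro: rtrancl_trans)
qed

lemma components_eq_clusters:
  assumes "graph V F"
  shows "components V F = (\<lambda>v. cluster F {v}) ` V"
proof -
  have "connected_rel V F `` {v} = cluster F {v}" if "v \<in> V" for v
    using cluster_subset_vertices[OF assms that] that
    by (auto simp: connected_rel_def cluster_def)
  then show ?thesis
    by (auto simp: components_def quotient_def)
qed

lemma largest_component_is_cluster:
  assumes "graph V F"
  obtains v where "v \<in> V" "largest_component V F = cluster F {v}"
proof -
  have V: "finite V" "V \<noteq> {}" using assms by (auto simp: graph_def)
  then obtain v where v: "v \<in> V" by blast
  have "\<forall>C. C \<in> components V F \<longrightarrow> card C \<le> card V"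
    using cluster_subset_vertices[OF assms] V(1)
    by (auto simp: components_eq_clusters[OF assms] intro: card_mono)
  then have "largest_component V F \<in> components V F"
    unfolding largest_component_def
    using arg_max_natI[of "\<lambda>C. C \<in> components V F" "cluster F {v}" card "Suc (card V)"] v
    by (auto simp: components_eq_clusters[OF assms] less_Suc_eq_le)
  then show thesis
    using that by (auto simp: components_eq_clusters[OF assms])
qed

text \<open>All vertices of a component share the same cluster, so a component with at least \<open>k\<close> vertices
  contributes all of them to the vertices with large clusters.\<close>

lemma card_largest_component_le:
  assumes "graph V F" "k \<le> card (largest_component V F)"
  shows "card (largest_component V F) \<le> card {v \<in> V. k \<le> card (cluster F {v})}"
proof -
  obtain v where v: "v \<in> V" "largest_component V F = cluster F {v}"
    using largest_component_is_cluster[OF assms(1)] .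
  have "cluster F {v} \<subseteq> {u \<in> V. k \<le> card (cluster F {u})}"
    using cluster_subset_vertices[OF assms(1) v(1)] assms(2) v(2) cluster_eq_cluster[of _ F v]
    by auto
  then show ?thesis
    unfolding v(2) using assms(1) by (intro card_mono) (auto simp: graph_def)
qed

section \<open>Revealing one edge of a percolation\<close>

lemma set_percolation_subset:
  assumes "finite E"
  shows "set_pmf (percolation E p) \<subseteq> Pow E"
  by (auto simp: percolation_def)

lemma integrable_percolation:
  fixes f :: "'a set set \<Rightarrow> real"
  assumes "finite E"
  shows "integrable (measure_pmf (percolation E p)) f"
  by (rule integrable_measure_pmf_finite)
    (use finite_subset[OF set_percolation_subset[OF assms]] assms in auto)

lemma percolation_insert:
  assumes "finite E" "e \<notin> E"
  shows "percolation (insert e E) p =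
    bind_pmf (bernoulli_pmf p) (\<lambda>b. map_pmf (if b then insert e else id) (percolation E p))"
proof -
  have "{x \<in> insert e E. (f(e := b)) x} = (if b then insert e else id) {x \<in> E. f x}" for f b
    using assms(2) by auto
  then show ?thesis
    by (simp only: percolation_def Pi_pmf_insert'[OF assms] map_pmf_def bind_assoc_pmf
        bind_return_pmf)
qed

lemma expectation_percolation_insert:
  fixes f :: "'a set set \<Rightarrow> real"
  assumes "finite E" "e \<notin> E" "0 \<le> p" "p \<le> 1"
  shows "measure_pmf.expectation (percolation (insert e E) p) f =
     (1 - p) * measure_pmf.expectation (percolation E p) f +
     p * measure_pmf.expectation (percolation E p) (\<lambda>F. f (insert e F))"
proof -
  have fin: "finite (set_pmf (percolation E p))"
    using finite_subset[OF set_percolation_subset[OF assms(1)]] assms(1) by auto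
  show ?thesis
    unfolding percolation_insert[OF assms(1,2)]
    using assms(3,4) fin
    by (subst pmf_expectation_bind[of "UNIV :: bool set"]) (auto simp: UNIV_bool)
qed

lemma prob_eq_expectation:
  "measure_pmf.prob M {x. P x} = measure_pmf.expectation M (\<lambda>x. of_bool (P x))"
proof -
  have "(\<lambda>x. of_bool (P x) :: real) = indicator {x. P x}"
    by (auto simp: indicator_def)
  then show ?thesis by simp
qed

lemma expectation_percolation_mono:
  fixes f g :: "'a set set \<Rightarrow> real"
  assumes "finite E" "\<And>F. F \<subseteq> E \<Longrightarrow> f F \<le> g F"
  shows "measure_pmf.expectation (percolation E p) f \<le>
    measure_pmf.expectation (percolation E p) g"
  by (rule integral_mono_AE)
    (use assms set_percolation_subset[OF assms(1)] integrable_percolation[OF assms(1)]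
      in \<open>auto simp: AE_measure_pmf_iff\<close>)

lemma expectation_percolation_cong:
  fixes f g :: "'a set set \<Rightarrow> real"
  assumes "finite E" "\<And>F. F \<subseteq> E \<Longrightarrow> f F = g F"
  shows "measure_pmf.expectation (percolation E p) f =
    measure_pmf.expectation (percolation E p) g"
  using expectation_percolation_mono[of E f g] expectation_percolation_mono[of E g f] assms
  by (intro antisym) auto

text \<open>One step of the exploration. The only randomness left after revealing the edge is the percolation
  on the remaining edges, because the fate of the revealed one is absorbed in the set of found
  vertices.\<close>

lemma expectation_reveal_edge:
  fixes f :: "'a set \<Rightarrow> real"
  assumes "finite E" "{a, b} \<notin> E" "a \<in> A" "0 \<le> p" "p \<le> 1"
  shows "measure_pmf.expectation (percolation (insert {a, b} E) p) (\<lambda>F. f (cluster F A)) =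
     (1 - p) * measure_pmf.expectation (percolation E p) (\<lambda>F. f (cluster F A)) +
     p * measure_pmf.expectation (percolation E p) (\<lambda>F. f (cluster F (insert b A)))"
  by (simp add: expectation_percolation_insert[OF assms(1,2,4,5)] cluster_insert_edge[OF assms(3)])

section \<open>Exploring a cluster edge by edge\<close>

text \<open>For a set \<open>A\<close> of found vertices this counts the edges still to be explored. An edge with both ends
  in \<open>A\<close> counts once, since revealing it uses it up.\<close>

definition touching_edges :: "'a set set \<Rightarrow> 'a set \<Rightarrow> nat" where
  "touching_edges E A = card {e \<in> E. e \<inter> A \<noteq> {}}"

lemma touching_singleton: "touching_edges E {v} = degree E v"
  by (simp add: touching_edges_def degree_def)

lemma touching_insert_edge:
  assumes "finite E" "e \<notin> E" "e \<inter> A \<noteq> {}"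
  shows "touching_edges (insert e E) A = Suc (touching_edges E A)"
proof -
  have "{x \<in> insert e E. x \<inter> A \<noteq> {}} = insert e {x \<in> E. x \<inter> A \<noteq> {}}"
    using assms(3) by auto
  then show ?thesis using assms(1,2) by (simp add: touching_edges_def)
qed

lemma touching_insert_vertex:
  assumes "finite E"
  shows "touching_edges E (insert b A) \<le> touching_edges E A + degree E b"
proof -
  have "{x \<in> E. x \<inter> insert b A \<noteq> {}} \<subseteq> {x \<in> E. x \<inter> A \<noteq> {}} \<union> {x \<in> E. b \<in> x}"
    by auto
  then have "touching_edges E (insert b A) \<le> card ({x \<in> E. x \<inter> A \<noteq> {}} \<union> {x \<in> E. b \<in> x})"
    unfolding touching_edges_def using assms by (intro card_mono) auto
  also have "\<dots> \<le> touching_edges E A + degree E b"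
    unfolding touching_edges_def degree_def by (rule card_Un_le)
  finally show ?thesis .
qed

lemma degree_insert_edge:
  assumes "finite E" "e \<notin> E" "v \<in> e"
  shows "degree (insert e E) v = Suc (degree E v)"
  using touching_insert_edge[of E e "{v}"] assms by (simp add: touching_singleton)

lemma degree_mono:
  assumes "finite E" "E' \<subseteq> E"
  shows "degree E' v \<le> degree E v"
  unfolding degree_def using assms by (intro card_mono) auto

text \<open>The induction behind every statement about the exploration: as long as some edge touches the set
  \<open>A\<close> of found vertices, it is revealed, and the remaining graph is explored from \<open>A\<close> or from
  \<open>insert b A\<close>. When no edge touches \<open>A\<close>, the cluster is \<open>A\<close> itself.\<close>

lemma exploration_induct [consumes 2, case_names no_edge edge]:
  assumes "finite E" "\<forall>e\<in>E. card e = 2"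
  assumes base: "\<And>E A. finite E \<Longrightarrow> (\<forall>e\<in>E. card e = 2) \<Longrightarrow>
     (\<forall>e\<in>E. e \<inter> A = {}) \<Longrightarrow> P E A"
  assumes step: "\<And>E A a b. finite E \<Longrightarrow> (\<forall>e\<in>E. card e = 2) \<Longrightarrow>
     a \<in> A \<Longrightarrow> a \<noteq> b \<Longrightarrow> {a, b} \<notin> E \<Longrightarrow> P E A \<Longrightarrow> P E (insert b A) \<Longrightarrow>
     P (insert {a, b} E) A"
  shows "P E A"
  using assms(1,2)
proof (induction "card E" arbitrary: E A)
  case (0 E A)
  then show ?case by (intro base) auto
next
  case (Suc n E A)
  show ?case
  proof (cases "\<exists>e\<in>E. e \<inter> A \<noteq> {}")
    case False
    with Suc.prems show ?thesis by (intro base) auto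
  next
    case True
    then obtain e a where e: "e \<in> E" "a \<in> e" "a \<in> A" by auto
    obtain b where b: "e = {a, b}" "a \<noteq> b"
      using bspec[OF Suc.prems(2) e(1)] e(2) unfolding card_2_iff by blast
    let ?E = "E - {e}"
    have "card ?E = n" using Suc.hyps(2) e(1) Suc.prems(1) by simp
    then have IH: "P ?E B" for B
      using Suc.hyps(1)[of ?E B] Suc.prems by auto
    have "P (insert {a, b} ?E) A"
      by (rule step) (use Suc.prems e b IH in auto)
    then show ?thesis using b e(1) by (simp add: insert_absorb)
  qed
qed

text \<open>The potential \<open>t\<close> to the number of found vertices times \<open>w\<close> to the number of unexplored edges at
  them does not decrease in mean when an edge is revealed. If the edge is open, one vertex with at
  most \<open>d - 1\<close> further edges is found, so relative to the potential without the revealed edge the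
  mean is at least \<open>1 - p + p t w^(d - 1)\<close>, which has to beat the lost factor \<open>w\<close>. Cycles only help,
  because \<open>w \<le> 1\<close>.\<close>

lemma cluster_generating_function:
  fixes t w p :: real
  assumes "finite E" "\<forall>e\<in>E. card e = 2" "finite A" "\<And>v. degree E v \<le> d"
    and p: "0 \<le> p" "p \<le> 1" and t: "0 \<le> t" and w: "0 < w" "w \<le> 1"
    and sub: "w \<le> 1 - p + p * t * w ^ (d - 1)"
  shows "t ^ card A * w ^ touching_edges E A
    \<le> measure_pmf.expectation (percolation E p) (\<lambda>F. t ^ card (cluster F A))"
  using assms(1-4)
proof (induction E A rule: exploration_induct)
  case (no_edge E A)
  have "{e \<in> E. e \<inter> A \<noteq> {}} = {}"
    using no_edge(3) by blast
  then have "touching_edges E A = 0"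
    unfolding touching_edges_def by (metis card.empty)
  moreover have "measure_pmf.expectation (percolation E p) (\<lambda>F. t ^ card (cluster F A)) =
    measure_pmf.expectation (percolation E p) (\<lambda>F. t ^ card A)"
    by (rule expectation_percolation_cong[OF no_edge(1)])
      (use no_edge(3) in \<open>metis cluster_eq_self subsetD\<close>)
  ultimately show ?case by simp
next
  case (edge E A a b)
  let ?\<mu> = "\<lambda>A. measure_pmf.expectation (percolation E p) (\<lambda>F. t ^ card (cluster F A))"
  let ?D = "touching_edges E A"
  have deg: "degree E v \<le> d" for v
    using order_trans[OF degree_mono edge.prems(2)] edge(1) by blast
  have IH1: "t ^ card A * w ^ ?D \<le> ?\<mu> A"
    using edge.IH(1)[OF edge.prems(1) deg] .
  have IH2: "t ^ card (insert b A) * w ^ touching_edges E (insert b A) \<le> ?\<mu> (insert b A)"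
    using edge.IH(2)[OF _ deg] edge.prems(1) by simp
  have "t ^ card A * w ^ Suc ?D \<le> (1 - p) * ?\<mu> A + p * ?\<mu> (insert b A)"
  proof (cases "b \<in> A")
    case True
    have "t ^ card A * w ^ Suc ?D \<le> t ^ card A * w ^ ?D"
      using t w by (intro mult_left_mono power_decreasing) auto
    also have "\<dots> \<le> ?\<mu> A" by (rule IH1)
    also have "\<dots> = (1 - p) * ?\<mu> A + p * ?\<mu> (insert b A)"
      using True by (simp add: insert_absorb algebra_simps)
    finally show ?thesis .
  next
    case False
    have "Suc (degree E b) \<le> d"
      using degree_insert_edge[of E "{a, b}" b] edge(1,5) edge.prems(2)[of b] by simp
    then have "touching_edges E (insert b A) \<le> ?D + (d - 1)"
      using touching_insert_vertex[OF edge(1), of b A] by linarith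
    then have "w ^ (?D + (d - 1)) \<le> w ^ touching_edges E (insert b A)"
      using w by (intro power_decreasing) auto
    then have "t ^ Suc (card A) * w ^ (?D + (d - 1)) \<le>
        t ^ card (insert b A) * w ^ touching_edges E (insert b A)"
      using t False edge.prems(1) by (simp add: mult_left_mono)
    with IH2 have open_case: "t ^ Suc (card A) * w ^ (?D + (d - 1)) \<le> ?\<mu> (insert b A)"
      by linarith
    have "t ^ card A * w ^ Suc ?D = t ^ card A * w ^ ?D * w"
      by simp
    also have "\<dots> \<le> t ^ card A * w ^ ?D * (1 - p + p * t * w ^ (d - 1))"
      using t w sub by (intro mult_left_mono) auto
    also have "\<dots> = (1 - p) * (t ^ card A * w ^ ?D) + p * (t ^ Suc (card A) * w ^ (?D + (d - 1)))"
      by (simp add: algebra_simps power_add)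
    also have "\<dots> \<le> (1 - p) * ?\<mu> A + p * ?\<mu> (insert b A)"
      using p IH1 open_case by (intro add_mono mult_left_mono) auto
    finally show ?thesis .
  qed
  then show ?case
    using edge(1,3,5) touching_insert_edge[of E "{a, b}" A]
      expectation_reveal_edge[of E a b A p "\<lambda>C. t ^ card C"] p by simp
qed

lemma cluster_tail_from_generating_function:
  fixes t w p :: real
  assumes "finite E" "\<forall>e\<in>E. card e = 2" "\<And>v. degree E v \<le> d"
    and p: "0 \<le> p" "p \<le> 1" and t: "0 \<le> t" "t \<le> 1" and w: "0 < w" "w \<le> 1"
    and sub: "w \<le> 1 - p + p * t * w ^ (d - 1)"
  shows "measure_pmf.prob (percolation E p) {F. k \<le> card (cluster F {v})} * (1 - t ^ k)
    \<le> 1 - t * w ^ d"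
proof -
  let ?S = "{F. k \<le> card (cluster F {v})}"
  have "t * w ^ d \<le> t * w ^ degree E v"
    using t w assms(3) by (intro mult_left_mono power_decreasing) auto
  also have "\<dots> \<le> measure_pmf.expectation (percolation E p) (\<lambda>F. t ^ card (cluster F {v}))"
    using cluster_generating_function[OF assms(1,2) _ assms(3) p t(1) w sub, of "{v}"]
    by (simp add: touching_singleton)
  also have "\<dots> \<le> measure_pmf.expectation (percolation E p) (\<lambda>F. 1 - indicator ?S F * (1 - t ^ k))"
    using t by (intro expectation_percolation_mono assms(1))
      (auto simp: indicator_def power_le_one power_decreasing)
  also have "\<dots> = 1 - measure_pmf.prob (percolation E p) ?S * (1 - t ^ k)"
    by (simp add: integrable_percolation[OF assms(1)])
  finally show ?thesis by simp
qed

text \<open>A change of measure from \<open>p\<close> to \<open>q\<close> along the exploration, stopped as soon as \<open>k\<close> vertices are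
  found. Each open edge contributes \<open>p/q \<le> 1\<close> to the likelihood ratio and each closed edge
  \<open>(1 - p)/(1 - q) \<ge> 1\<close>. There are \<open>k - card A\<close> vertices still to be found, each by one open
  edge to it, and the number of closed edges is bounded by the edges at \<open>A\<close> plus a net gain of \<open>d - 2\<close>
  for each vertex found: it brings at most \<open>d - 1\<close> new edges, and the open edge leading to it is
  used up.\<close>

lemma cluster_tail_comparison:
  fixes p q :: real
  assumes "finite E" "\<forall>e\<in>E. card e = 2" "finite A" "\<And>v. degree E v \<le> d"
    and d: "2 \<le> d" and p: "0 < p" "p \<le> q" "q < 1"
  shows "measure_pmf.prob (percolation E p) {F. k \<le> card (cluster F A)} \<le>
    (p / q) ^ (k - card A) * ((1 - p) / (1 - q)) ^ (touching_edges E A + (k - card A) * (d - 2)) *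
    measure_pmf.prob (percolation E q) {F. k \<le> card (cluster F A)}"
  using assms(1-4)
proof (induction E A rule: exploration_induct)
  case (no_edge E A)
  let ?\<mu> = "\<lambda>p. measure_pmf.prob (percolation E p) {F. k \<le> card (cluster F A)}"
  have "?\<mu> p = of_bool (k \<le> card A)" for p
  proof -
    have "?\<mu> p = measure_pmf.expectation (percolation E p) (\<lambda>F. of_bool (k \<le> card A))"
      unfolding prob_eq_expectation
      by (rule expectation_percolation_cong[OF no_edge(1)])
        (use no_edge(3) in \<open>metis cluster_eq_self subsetD\<close>)
    then show ?thesis by simp
  qed
  moreover have "1 \<le> ((1 - p) / (1 - q)) ^ n" for n
    using p by (intro one_le_power) simp
  ultimately show ?case by simp
next
  case (edge E A a b)
  let ?\<mu> = "\<lambda>p A. measure_pmf.prob (percolation E p) {F. k \<le> card (cluster F A)}"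
  let ?D = "touching_edges E A" and ?r = "p / q" and ?s = "(1 - p) / (1 - q)"
  have r: "0 < ?r" and s: "1 \<le> ?s" using p by auto
  have deg: "degree E v \<le> d" for v
    using order_trans[OF degree_mono edge.prems(2)] edge(1) by blast
  have IH1: "?\<mu> p A \<le> ?r ^ (k - card A) * ?s ^ (?D + (k - card A) * (d - 2)) * ?\<mu> q A"
    using edge.IH(1)[OF edge.prems(1) deg] .
  have IH2: "?\<mu> p (insert b A) \<le> ?r ^ (k - card (insert b A)) *
      ?s ^ (touching_edges E (insert b A) + (k - card (insert b A)) * (d - 2)) * ?\<mu> q (insert b A)"
    using edge.IH(2)[OF _ deg] edge.prems(1) by simp
  let ?E = "insert {a, b} E"
  have step: "measure_pmf.prob (percolation ?E x) {F. k \<le> card (cluster F A)} =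
      (1 - x) * ?\<mu> x A + x * ?\<mu> x (insert b A)" if "0 \<le> x" "x \<le> 1" for x
    using expectation_reveal_edge[OF edge(1,5,3) that, of "\<lambda>C. of_bool (k \<le> card C)"]
    unfolding prob_eq_expectation .
  show ?case
  proof (cases "card A < k")
    case False
    have "measure_pmf.prob (percolation ?E x) {F. k \<le> card (cluster F A)} = 1" for x
    proof -
      have "k \<le> card (cluster F A)" if "F \<subseteq> ?E" for F
      proof -
        have "finite (cluster F A)"
          using that edge(1,2,4) edge.prems(1) finite_subset[OF that]
          by (intro finite_cluster) (auto simp: subset_iff)
        then show ?thesis
          using False card_mono[OF _ subset_cluster[of A F]] by fastforce
      qed
      then have "measure_pmf.prob (percolation ?E x) {F. k \<le> card (cluster F A)} =
          measure_pmf.expectation (percolation ?E x) (\<lambda>F. 1)"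
        unfolding prob_eq_expectation using edge(1)
        by (intro expectation_percolation_cong) auto
      then show ?thesis by simp
    qed
    then show ?thesis using False s by (simp add: one_le_power)
  next
    case True
    let ?K = "?r ^ (k - card A) * ?s ^ (Suc ?D + (k - card A) * (d - 2))"
    have "(1 - p) * ?\<mu> p A \<le>
        (1 - p) * (?r ^ (k - card A) * ?s ^ (?D + (k - card A) * (d - 2)) * ?\<mu> q A)"
      using p IH1 by (intro mult_left_mono) auto
    also have "\<dots> = ?K * ((1 - q) * ?\<mu> q A)"
      using p by (simp add: field_simps)
    finally have closed: "(1 - p) * ?\<mu> p A \<le> ?K * ((1 - q) * ?\<mu> q A)" .
    have opened: "p * ?\<mu> p (insert b A) \<le> ?K * (q * ?\<mu> q (insert b A))"
    proof (cases "b \<in> A")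
      case True
      have "p * ?\<mu> p (insert b A) \<le>
          q * (?r ^ (k - card A) * ?s ^ (?D + (k - card A) * (d - 2)) * ?\<mu> q A)"
        using p IH1 True by (intro mult_mono) (auto simp: insert_absorb)
      also have "\<dots> \<le> q * (?K * ?\<mu> q A)"
        using p s by (intro mult_left_mono mult_right_mono power_increasing) auto
      finally show ?thesis using True by (simp add: insert_absorb mult_ac)
    next
      case False
      obtain j where j: "k - card A = Suc j" "k - card (insert b A) = j"
        using \<open>card A < k\<close> False edge.prems(1)
        by (metis Suc_diff_Suc card_insert_disjoint)
      have "Suc (degree E b) \<le> d"
        using degree_insert_edge[of E "{a, b}" b] edge(1,5) edge.prems(2)[of b] by simp
      then have touch: "touching_edges E (insert b A) + j * (d - 2) \<le> Suc ?D + Suc j * (d - 2)"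
        using touching_insert_vertex[OF edge(1), of b A] d by simp
      have "p * ?\<mu> p (insert b A) \<le>
          p * (?r ^ j * ?s ^ (touching_edges E (insert b A) + j * (d - 2)) * ?\<mu> q (insert b A))"
        using IH2 p unfolding j by (intro mult_left_mono) auto
      also have "\<dots> \<le> p * (?r ^ j * ?s ^ (Suc ?D + Suc j * (d - 2)) * ?\<mu> q (insert b A))"
        using p s touch
        by (intro mult_left_mono mult_right_mono power_increasing) auto
      also have "\<dots> = ?K * (q * ?\<mu> q (insert b A))"
        using p unfolding j by simp
      finally show ?thesis .
    qed
    have "(1 - p) * ?\<mu> p A + p * ?\<mu> p (insert b A) \<le>
      ?K * ((1 - q) * ?\<mu> q A + q * ?\<mu> q (insert b A))"
      using add_mono[OF closed opened] by (simp only: distrib_left)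
    then show ?thesis
      using step[of p] step[of q] p edge(1,3,5) touching_insert_edge[of E "{a, b}" A]
      by simp
  qed
qed

section \<open>Tail of the cluster of a vertex\<close>

text \<open>The generating function of \<open>Bin(m, q)\<close> at \<open>1 - x\<close> is \<open>(1 - y/m)\<^sup>m\<close> with \<open>y = m q x\<close>. For fixed \<open>y\<close> it
  increases with \<open>m\<close>, by concavity of the logarithm. Its value at \<open>m = 2\<close> therefore gives a quadratic
  lower bound that is uniform in the degree.\<close>

lemma square_le_power_one_minus:
  fixes y :: real
  assumes "2 \<le> m" "0 \<le> y" "y < 2"
  shows "(1 - y / 2)\<^sup>2 \<le> (1 - y / real m) ^ m"
proof -
  have m: "2 \<le> real m" using assms(1) by simp
  have "y / real m < 1" using assms m by (simp add: divide_less_eq)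
  have "(1 - 2 / real m) * ln 1 + 2 / real m * ln (1 - y / 2) \<le>
      ln ((1 - 2 / real m) * 1 + 2 / real m * (1 - y / 2))"
    using concave_onD[OF ln_concave, of "2 / real m" 1 "1 - y / 2"] assms m
    by (auto simp: divide_le_eq)
  also have "(1 - 2 / real m) * 1 + 2 / real m * (1 - y / 2) = 1 - y / real m"
    using m by (simp add: field_simps)
  finally have "real m * (2 / real m * ln (1 - y / 2)) \<le> real m * ln (1 - y / real m)"
    using m by (intro mult_left_mono) auto
  then have "2 * ln (1 - y / 2) \<le> real m * ln (1 - y / real m)"
    using m by simp
  then have "ln ((1 - y / 2)\<^sup>2) \<le> ln ((1 - y / real m) ^ m)"
    using assms \<open>y / real m < 1\<close> by (simp add: ln_realpow)
  then show ?thesis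
    using assms \<open>y / real m < 1\<close> by (subst (asm) ln_le_cancel_iff) auto
qed

text \<open>Here \<open>1 - x\<close> is the value \<open>z\<close> at which the offspring generating function is evaluated, \<open>t\<close> is chosen so
  that \<open>1 - x = t w^(d - 1)\<close>, and \<open>\<delta>\<close> measures how far \<open>t\<close> is below one: \<open>t \<le> 1/(1 + \<delta>)\<close>. When \<open>\<delta>\<close> is at
  least \<open>1/k\<close>, \<open>t\<^sup>k \<le> 1/2\<close>, and the tail is at most twice \<open>1 - t w\<^sup>d\<close>, which is of order \<open>x\<close>.\<close>

lemma near_critical_cluster_tail:
  fixes \<epsilon> x \<delta> p :: real
  assumes "finite E" "\<forall>e\<in>E. card e = 2" "\<And>v. degree E v \<le> d" "3 \<le> d"
    and p: "0 \<le> p" "p \<le> 1" "p \<le> (1 + \<epsilon>) / (real d - 1)" and "0 \<le> \<epsilon>"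
    and x: "0 < x" "x < 1" "(1 + \<epsilon>) * x < 2"
    and \<delta>: "0 \<le> \<delta>" "1 \<le> real k * \<delta>" "(1 - x) * (1 + \<delta>) \<le> (1 - (1 + \<epsilon>) * x / 2)\<^sup>2"
  shows "measure_pmf.prob (percolation E p) {F. k \<le> card (cluster F {v})} \<le> (3 + \<epsilon>) * x"
proof -
  define q where "q = (1 + \<epsilon>) / (real d - 1)"
  define w where "w = 1 - q * x"
  define t where "t = (1 - x) / w ^ (d - 1)"
  let ?P = "measure_pmf.prob (percolation E p) {F. k \<le> card (cluster F {v})}"
  have d: "real (d - 1) = real d - 1" "2 \<le> real d - 1" using assms(4) by auto
  have q: "0 \<le> q" "q \<le> (1 + \<epsilon>) / 2"
    using d \<open>0 \<le> \<epsilon>\<close> divide_left_mono[of 2 "real d - 1" "1 + \<epsilon>"] unfolding q_def by simp_all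
  have qx: "0 \<le> q * x" "q * x \<le> (1 + \<epsilon>) * x / 2"
    using q x mult_right_mono[OF q(2), of x] by auto
  have "q * x < 1"
    by (rule order_le_less_trans[OF qx(2)]) (use x(3) in simp)
  then have w: "0 < w" "w \<le> 1" using qx unfolding w_def by auto
  have wd: "(1 - x) * (1 + \<delta>) \<le> w ^ (d - 1)"
  proof -
    have "(1 - (1 + \<epsilon>) * x / 2)\<^sup>2 \<le> (1 - (1 + \<epsilon>) * x / real (d - 1)) ^ (d - 1)"
      using assms(4) x \<open>0 \<le> \<epsilon>\<close> by (intro square_le_power_one_minus) auto
    with \<delta>(3) have "(1 - x) * (1 + \<delta>) \<le> (1 - (1 + \<epsilon>) * x / real (d - 1)) ^ (d - 1)"
      by linarith
    then show ?thesis by (simp only: w_def q_def d(1) times_divide_eq_left)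
  qed
  have t: "0 \<le> t" "t * (1 + \<delta>) \<le> 1" and tw: "t * w ^ (d - 1) = 1 - x"
    using wd w x \<delta> by (auto simp: t_def divide_le_eq)
  have "t \<le> 1"
    using t \<delta>(1) mult_left_mono[of 1 "1 + \<delta>" t] by simp
  \<comment> \<open>Bernoulli's inequality and \<open>k \<delta> \<ge> 1\<close> give \<open>(1 + \<delta>)\<^sup>k \<ge> 2\<close>.\<close>
  have "t ^ k * 2 \<le> t ^ k * (1 + \<delta>) ^ k"
    using t \<delta> Bernoulli_inequality[of \<delta> k] by (intro mult_left_mono) auto
  also have "\<dots> \<le> 1"
    using t \<delta> by (simp add: power_le_one flip: power_mult_distrib)
  finally have tk: "1 / 2 \<le> 1 - t ^ k" by simp
  have "w \<le> 1 - p * x"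
    using p(3) x mult_right_mono[of p q x] by (simp add: w_def q_def)
  also have "\<dots> = 1 - p + p * (1 - x)"
    by (simp add: algebra_simps)
  also have "\<dots> = 1 - p + p * t * w ^ (d - 1)"
    by (simp only: tw mult.assoc)
  finally have sub: "w \<le> 1 - p + p * t * w ^ (d - 1)" .
  have "?P * (1 / 2) \<le> ?P * (1 - t ^ k)"
    using tk by (intro mult_left_mono) auto
  also have "\<dots> \<le> 1 - t * w ^ d"
    using cluster_tail_from_generating_function[OF assms(1-3) p(1,2) t(1) \<open>t \<le> 1\<close> w sub] .
  also have "t * w ^ d = (1 - x) * w"
    using assms(4) power_Suc2[of w "d - 1"] tw by simp
  also have "1 - (1 - x) * w \<le> x + q * x"
    using mult_nonneg_nonneg[OF qx(1), of x] x unfolding w_def by (simp add: algebra_simps)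
  also have "\<dots> \<le> x + (1 + \<epsilon>) * x / 2"
    using qx by simp
  also have "\<dots> = (3 + \<epsilon>) * x * (1 / 2)"
    by (simp add: field_simps)
  finally show ?thesis by simp
qed

text \<open>At criticality the linear terms cancel and \<open>\<delta> = x\<^sup>2/4\<close> is admissible, so \<open>x = 2/sqrt k\<close> is the
  choice with \<open>k \<delta> = 1\<close>.\<close>

lemma critical_cluster_tail:
  fixes p :: real
  assumes "finite E" "\<forall>e\<in>E. card e = 2" "\<And>v. degree E v \<le> d" "3 \<le> d"
    and p: "0 \<le> p" "p \<le> 1 / (real d - 1)" and k: "1 \<le> k"
  shows "measure_pmf.prob (percolation E p) {F. k \<le> card (cluster F {v})} \<le> 6 / sqrt k"
proof (cases "k \<le> 36")
  case True
  then have "sqrt k \<le> sqrt 36" by (intro real_sqrt_le_mono) simp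
  also have "sqrt 36 = (6 :: real)" by (rule real_sqrt_unique) auto
  finally have "1 \<le> 6 / sqrt k" using k by (simp add: le_divide_eq)
  then show ?thesis by (rule order_trans[OF measure_pmf.prob_le_1])
next
  case False
  define x where "x = 2 / sqrt k"
  have "sqrt 4 < sqrt (real k)" using False by (intro real_sqrt_less_mono) simp
  then have x: "0 < x" "x < 1" "x\<^sup>2 = 4 / k"
    using k by (auto simp: x_def power_divide)
  have "1 / (real d - 1) \<le> 1" using assms(4) by simp
  with p have "p \<le> 1" by linarith
  \<comment> \<open>Here \<open>1/k = x\<^sup>2/4\<close>, and the right-hand side is \<open>1 - x + x\<^sup>2/4\<close>.\<close>
  have "(1 - x) * (1 + 1 / k) \<le> (1 - (1 + 0) * x / 2)\<^sup>2"
  proof -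
    have "(1 - x) * (1 + 1 / k) = 1 - x + (1 - x) * (x\<^sup>2 / 4)"
      using x(3) by (simp add: algebra_simps)
    also have "(1 - x) * (x\<^sup>2 / 4) \<le> 1 * (x\<^sup>2 / 4)"
      using x by (intro mult_right_mono) auto
    finally show ?thesis by (simp add: power2_eq_square algebra_simps)
  qed
  then have "measure_pmf.prob (percolation E p) {F. k \<le> card (cluster F {v})} \<le> (3 + 0) * x"
    using assms(1-4) p \<open>p \<le> 1\<close> x k
    by (intro near_critical_cluster_tail[where \<delta> = "1 / k"]) auto
  then show ?thesis by (simp add: x_def)
qed

text \<open>The drift \<open>\<epsilon> x\<close> has to be absorbed by half of the variance term \<open>x\<^sup>2/4\<close>, which forces
  \<open>x \<ge> 8 \<epsilon>\<close>; the other half gives \<open>\<delta> = x\<^sup>2/8\<close>, and \<open>x \<ge> 4/sqrt k\<close> ensures \<open>k \<delta> \<ge> 1\<close>.\<close>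

lemma supercritical_cluster_tail:
  fixes \<epsilon> p :: real
  assumes "finite E" "\<forall>e\<in>E. card e = 2" "\<And>v. degree E v \<le> d" "3 \<le> d"
    and p: "0 \<le> p" "p \<le> 1" "p \<le> (1 + \<epsilon>) / (real d - 1)" and "0 \<le> \<epsilon>" and k: "1 \<le> k"
  shows "measure_pmf.prob (percolation E p) {F. k \<le> card (cluster F {v})}
    \<le> 32 * \<epsilon> + 16 / sqrt k"
proof -
  define x where "x = 8 * \<epsilon> + 4 / sqrt k"
  show ?thesis
  proof (cases "x < 1")
    case False
    then have "1 \<le> 32 * \<epsilon> + 16 / sqrt k" by (simp add: x_def)
    then show ?thesis by (rule order_trans[OF measure_pmf.prob_le_1])
  next
    case True
    have x: "0 < x" "8 * \<epsilon> \<le> x" "4 / sqrt k \<le> x"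
      using k \<open>0 \<le> \<epsilon>\<close> by (auto simp: x_def add_nonneg_pos)
    have \<epsilon>: "\<epsilon> < 1 / 8" using x True by linarith
    have "(1 + \<epsilon>) * x \<le> (1 + \<epsilon>) * 1"
      using \<open>0 \<le> \<epsilon>\<close> True by (intro mult_left_mono) auto
    also have "(1 + \<epsilon>) * 1 < 2" using \<epsilon> by simp
    finally have "(1 + \<epsilon>) * x < 2" .
    have "(4 / sqrt k)\<^sup>2 \<le> x\<^sup>2" using x(3) by (intro power_mono) auto
    then have "1 \<le> real k * (x\<^sup>2 / 8)" using k by (simp add: power_divide field_simps)
    moreover have "(1 - x) * (1 + x\<^sup>2 / 8) \<le> (1 - (1 + \<epsilon>) * x / 2)\<^sup>2"
    proof -
      have "(1 - x) * (1 + x\<^sup>2 / 8) = 1 - x + (1 - x) * (x\<^sup>2 / 8)"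
        by (simp add: algebra_simps)
      also have "(1 - x) * (x\<^sup>2 / 8) \<le> 1 * (x\<^sup>2 / 8)"
        using x by (intro mult_right_mono) auto
      also have "1 - x + 1 * (x\<^sup>2 / 8) \<le> 1 - x + (x\<^sup>2 / 4 - \<epsilon> * x)"
        using mult_right_mono[OF x(2), of x] x(1) by (simp add: power2_eq_square)
      also have "\<dots> \<le> 1 - x - \<epsilon> * x + (1 + \<epsilon>)\<^sup>2 * (x\<^sup>2 / 4)"
        using mult_right_mono[of 1 "(1 + \<epsilon>)\<^sup>2" "x\<^sup>2 / 4"] \<open>0 \<le> \<epsilon>\<close> by simp
      also have "\<dots> = (1 - (1 + \<epsilon>) * x / 2)\<^sup>2"
        by (simp add: power2_eq_square field_simps)
      finally show ?thesis by simp
    qed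
    ultimately have "measure_pmf.prob (percolation E p) {F. k \<le> card (cluster F {v})}
        \<le> (3 + \<epsilon>) * x"
      using assms(1-4) p \<open>0 \<le> \<epsilon>\<close> x(1) True \<open>(1 + \<epsilon>) * x < 2\<close>
      by (intro near_critical_cluster_tail[where \<delta> = "x\<^sup>2 / 8"]) auto
    also have "\<dots> \<le> 4 * x"
      using x(1) \<epsilon> by (intro mult_right_mono) auto
    finally show ?thesis by (simp add: x_def)
  qed
qed

lemma ln_one_plus_le_cubic:
  fixes x :: real
  assumes "0 \<le> x"
  shows "ln (1 + x) \<le> x - x\<^sup>2 / 2 + x ^ 3 / 3"
proof -
  let ?f = "\<lambda>x :: real. x - x\<^sup>2 / 2 + x ^ 3 / 3 - ln (1 + x)"
  have "?f 0 \<le> ?f x"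
  proof (rule DERIV_nonneg_imp_nondecreasing[OF assms])
    fix y :: real assume y: "0 \<le> y" "y \<le> x"
    have "(?f has_real_derivative (1 - y + y\<^sup>2 - 1 / (1 + y))) (at y)"
      using y by (auto intro!: derivative_eq_intros)
    moreover have "1 - y + y\<^sup>2 - 1 / (1 + y) = y ^ 3 / (1 + y)"
      using y by (simp add: field_simps power2_eq_square power3_eq_cube)
    ultimately show "\<exists>D. (?f has_real_derivative D) (at y) \<and> 0 \<le> D"
      using y by (intro exI[of _ "y ^ 3 / (1 + y)"]) auto
  qed
  then show ?thesis by simp
qed

lemma ln_one_minus_le_quadratic:
  fixes x :: real
  assumes "0 \<le> x" "x < 1"
  shows "ln (1 - x) \<le> - x - x\<^sup>2 / 2"
proof -
  let ?f = "\<lambda>x :: real. - x - x\<^sup>2 / 2 - ln (1 - x)"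
  have "?f 0 \<le> ?f x"
  proof (rule DERIV_nonneg_imp_nondecreasing[OF assms(1)])
    fix y :: real assume y: "0 \<le> y" "y \<le> x"
    have "(?f has_real_derivative (- 1 - y + 1 / (1 - y))) (at y)"
      using y assms by (auto intro!: derivative_eq_intros)
    moreover have "- 1 - y + 1 / (1 - y) = y\<^sup>2 / (1 - y)"
      using y assms by (simp add: field_simps power2_eq_square)
    ultimately show "\<exists>D. (?f has_real_derivative D) (at y) \<and> 0 \<le> D"
      using y assms by (intro exI[of _ "y\<^sup>2 / (1 - y)"]) auto
  qed
  then show ?thesis by simp
qed

text \<open>The likelihood ratio per found vertex, with \<open>m = d - 2\<close>. The first order terms of the two
  logarithms cancel, and the second order terms add up to \<open>- \<epsilon>\<^sup>2/2 (1 + 1/m)\<close>, in which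
  \<open>m/(m + 1) = (d - 2)/(d - 1)\<close> is the variance of the critical offspring law. The factor
  \<open>1 - \<epsilon>\<close> absorbs the third order term.\<close>

lemma change_of_measure_rate:
  fixes \<epsilon> :: real
  assumes "0 \<le> \<epsilon>" "\<epsilon> < 1" "1 \<le> m"
  shows "(1 - \<epsilon>) * (1 + \<epsilon> / real m) ^ m \<le>
    exp (- (\<epsilon>\<^sup>2 / 2 * ((real m + 1) / real m) * (1 - \<epsilon>)))"
proof -
  have m: "1 \<le> real m" using assms(3) by simp
  let ?y = "\<epsilon> / real m"
  have y: "0 \<le> ?y" using assms(1) by simp
  have "real m * ln (1 + ?y) \<le> real m * (?y - ?y\<^sup>2 / 2 + ?y ^ 3 / 3)"
    using ln_one_plus_le_cubic[OF y] by (intro mult_left_mono) auto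
  also have "\<dots> = \<epsilon> - \<epsilon>\<^sup>2 / (2 * real m) + \<epsilon> ^ 3 / (3 * (real m)\<^sup>2)"
    using m by (simp add: field_simps power2_eq_square power3_eq_cube)
  also have "\<epsilon> ^ 3 / (3 * (real m)\<^sup>2) \<le> \<epsilon> ^ 3 / 2"
  proof (intro divide_left_mono)
    show "2 \<le> 3 * (real m)\<^sup>2" using one_le_power[OF m, of 2] by linarith
  qed (use m assms(1) in auto)
  finally have "ln (1 - \<epsilon>) + real m * ln (1 + ?y) \<le>
      - (\<epsilon>\<^sup>2 / 2) - \<epsilon>\<^sup>2 / (2 * real m) + \<epsilon> ^ 3 / 2"
    using ln_one_minus_le_quadratic[OF assms(1,2)] by linarith
  also have "\<dots> \<le> - (\<epsilon>\<^sup>2 / 2 * ((real m + 1) / real m) * (1 - \<epsilon>))"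
    using m assms(1) by (simp add: field_simps power2_eq_square power3_eq_cube)
  finally have "exp (ln (1 - \<epsilon>) + real m * ln (1 + ?y)) \<le>
      exp (- (\<epsilon>\<^sup>2 / 2 * ((real m + 1) / real m) * (1 - \<epsilon>)))"
    by simp
  moreover have "exp (ln (1 - \<epsilon>) + real m * ln (1 + ?y)) = (1 - \<epsilon>) * (1 + ?y) ^ m"
    using assms(2) y by (simp add: exp_add exp_of_nat_mult)
  ultimately show ?thesis by simp
qed

text \<open>The critical bound \<open>6/sqrt k\<close> times the likelihood ratio. The factor 8 between 6 and 48 covers the
  boundary effects: \<open>\<rho>\<^sup>2 \<le> 4\<close> for the additional edges at the root, and \<open>1/(1 - \<epsilon>) \<le> 2\<close> because the
  root is found without an open edge.\<close>

lemma subcritical_cluster_tail: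
  fixes \<epsilon> p :: real
  assumes "finite E" "\<forall>e\<in>E. card e = 2" "\<And>v. degree E v \<le> d" "3 \<le> d"
    and \<epsilon>: "0 \<le> \<epsilon>" "\<epsilon> \<le> 1 / 2" and p: "p = (1 - \<epsilon>) / (real d - 1)" and k: "1 \<le> k"
  shows "measure_pmf.prob (percolation E p) {F. k \<le> card (cluster F {v})} \<le>
    48 / sqrt k * exp (- (real k * (\<epsilon>\<^sup>2 / 2 * ((real d - 1) / (real d - 2)) * (1 - \<epsilon>))))"
proof -
  define q where "q = 1 / (real d - 1)"
  define m where "m = d - 2"
  define \<rho> where "\<rho> = 1 + \<epsilon> / real m"
  let ?R = "\<epsilon>\<^sup>2 / 2 * ((real m + 1) / real m) * (1 - \<epsilon>)"
  let ?P = "\<lambda>p. measure_pmf.prob (percolation E p) {F. k \<le> card (cluster F {v})}"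
  have m: "1 \<le> real m" "d = m + 2" "real d - 1 = real m + 1" "real d - 2 = real m"
    using assms(4) by (auto simp: m_def)
  have "1 - p = (real m + \<epsilon>) / (real m + 1)" "1 - q = real m / (real m + 1)"
    using m(1) unfolding p q_def m(3) by (auto simp: field_simps)
  then have "(1 - p) / (1 - q) = (real m + \<epsilon>) / real m"
    using m(1) by simp
  then have "(1 - p) / (1 - q) = \<rho>"
    using m(1) by (simp add: \<rho>_def add_divide_distrib)
  then have q: "0 < p" "p \<le> q" "q < 1" "p / q = 1 - \<epsilon>" "(1 - p) / (1 - q) = \<rho>"
    using \<epsilon> m(1) unfolding p q_def m(3) by (auto simp: divide_right_mono)
  have "\<epsilon> / real m \<le> \<epsilon>" using \<epsilon> m(1) by (simp add: divide_le_eq mult_le_cancel_left1)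
  then have \<rho>: "1 \<le> \<rho>" "\<rho> \<le> 2" using \<epsilon> m(1) by (auto simp: \<rho>_def)
  have "?P p \<le> (1 - \<epsilon>) ^ (k - 1) * \<rho> ^ (degree E v + (k - 1) * m) * ?P q"
    using cluster_tail_comparison[OF assms(1,2) _ assms(3) _ q(1-3), of "{v}" k] assms(4)
    by (simp add: q(4,5) touching_singleton m_def)
  also have "\<dots> \<le> (1 - \<epsilon>) ^ (k - 1) * \<rho> ^ (2 + k * m) * (6 / sqrt k)"
  proof -
    have "degree E v + (k - 1) * m \<le> (m + 2) + (k - 1) * m"
      using assms(3)[of v] m(2) by simp
    also have "\<dots> = 2 + k * m" using k by (simp add: algebra_simps mult_eq_if)
    finally have "\<rho> ^ (degree E v + (k - 1) * m) \<le> \<rho> ^ (2 + k * m)"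
      using \<rho>(1) by (rule power_increasing)
    then have "(1 - \<epsilon>) ^ (k - 1) * \<rho> ^ (degree E v + (k - 1) * m) \<le>
        (1 - \<epsilon>) ^ (k - 1) * \<rho> ^ (2 + k * m)"
      using \<epsilon> by (intro mult_left_mono) auto
    moreover have "?P q \<le> 6 / sqrt k"
      using q m(3) by (intro critical_cluster_tail[OF assms(1-4)] k) (simp_all add: q_def)
    ultimately show ?thesis
      using \<epsilon> \<rho> by (intro mult_mono) auto
  qed
  also have "\<dots> \<le> 8 * ((1 - \<epsilon>) * \<rho> ^ m) ^ k * (6 / sqrt k)"
  proof (intro mult_right_mono)
    have "1 * (1 - \<epsilon>) ^ (k - 1) \<le> (2 * (1 - \<epsilon>)) * (1 - \<epsilon>) ^ (k - 1)"
      using \<epsilon> by (intro mult_right_mono) auto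
    also have "\<dots> = 2 * (1 - \<epsilon>) ^ k" using k by (simp add: power_eq_if)
    finally have "(1 - \<epsilon>) ^ (k - 1) * \<rho> ^ (2 + k * m) \<le> (2 * (1 - \<epsilon>) ^ k) * (4 * \<rho> ^ (k * m))"
      unfolding power_add using \<rho> \<epsilon> power_mono[OF \<rho>(2), of 2]
      by (intro mult_mono mult_right_mono) auto
    then show "(1 - \<epsilon>) ^ (k - 1) * \<rho> ^ (2 + k * m) \<le> 8 * ((1 - \<epsilon>) * \<rho> ^ m) ^ k"
      by (simp add: power_mult_distrib power_mult[symmetric] mult.commute)
  qed auto
  also have "\<dots> \<le> 8 * exp (- ?R) ^ k * (6 / sqrt k)"
    using change_of_measure_rate[of \<epsilon> m] \<epsilon> m(1) \<rho> unfolding \<rho>_def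
    by (intro mult_right_mono mult_left_mono power_mono) auto
  also have "\<dots> = 48 / sqrt k * exp (- (real k * ?R))"
    by (simp flip: exp_of_nat_mult)
  finally show ?thesis by (simp only: m(3,4))
qed

section \<open>From the cluster of a vertex to the largest component\<close>

lemma graph_subset:
  assumes "graph V E" "F \<subseteq> E"
  shows "graph V F"
  using assms by (auto simp: graph_def)

lemma graph_finite_edges:
  assumes "graph V E"
  shows "finite E"
proof (rule finite_subset)
  show "E \<subseteq> Pow V" "finite (Pow V)" using assms by (auto simp: graph_def)
qed

lemma expectation_card_large_clusters:
  assumes "finite V" "finite E"
    and "\<And>v. v \<in> V \<Longrightarrow> measure_pmf.prob (percolation E p) {F. k \<le> card (cluster F {v})} \<le> q"
  shows "measure_pmf.expectation (percolation E p)
      (\<lambda>F. real (card {v \<in> V. k \<le> card (cluster F {v})})) \<le> real (card V) * q"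
proof -
  have "real (card {v \<in> V. k \<le> card (cluster F {v})}) =
      (\<Sum>v\<in>V. indicator {F. k \<le> card (cluster F {v})} F)" for F
    using assms(1) by (simp add: indicator_def sum.If_cases Int_def)
  then have "measure_pmf.expectation (percolation E p)
      (\<lambda>F. real (card {v \<in> V. k \<le> card (cluster F {v})})) =
      (\<Sum>v\<in>V. measure_pmf.prob (percolation E p) {F. k \<le> card (cluster F {v})})"
    by (simp add: Bochner_Integration.integral_sum integrable_percolation[OF assms(2)])
  also have "\<dots> \<le> real (card V) * q"
    using sum_bounded_above[of V _ q] assms(3) by simp
  finally show ?thesis .
qed

lemma prob_largest_component_le:
  assumes "graph V E"
    and "\<And>v. v \<in> V \<Longrightarrow> measure_pmf.prob (percolation E p) {F. k \<le> card (cluster F {v})} \<le> q"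
  shows "real k * measure_pmf.prob (percolation E p) {F. k \<le> card (largest_component V F)}
    \<le> real (card V) * q"
proof -
  have fin: "finite V" "finite E"
    using assms(1) graph_finite_edges by (auto simp: graph_def)
  have "real k * measure_pmf.prob (percolation E p) {F. k \<le> card (largest_component V F)} =
     measure_pmf.expectation (percolation E p)
       (\<lambda>F. real k * indicator {F. k \<le> card (largest_component V F)} F)"
    by simp
  also have "\<dots> \<le> measure_pmf.expectation (percolation E p)
      (\<lambda>F. real (card {v \<in> V. k \<le> card (cluster F {v})}))"
    using card_largest_component_le[OF graph_subset[OF assms(1)], of _ k] fin(2)
    by (intro expectation_percolation_mono) (auto simp: indicator_def intro: order_trans)
  also have "\<dots> \<le> real (card V) * q"
    using fin assms(2) by (rule expectation_card_large_clusters)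
  finally show ?thesis .
qed

lemma expectation_largest_component_le:
  assumes "graph V E"
    and "\<And>v. v \<in> V \<Longrightarrow> measure_pmf.prob (percolation E p) {F. k \<le> card (cluster F {v})} \<le> q"
  shows "measure_pmf.expectation (percolation E p) (\<lambda>F. real (card (largest_component V F)))
    \<le> real k + real (card V) * q"
proof -
  have fin: "finite V" "finite E"
    using assms(1) graph_finite_edges by (auto simp: graph_def)
  have "card (largest_component V F) \<le> k + card {v \<in> V. k \<le> card (cluster F {v})}"
    if "F \<subseteq> E" for F
    using card_largest_component_le[OF graph_subset[OF assms(1) that], of k] by linarith
  then have "measure_pmf.expectation (percolation E p) (\<lambda>F. real (card (largest_component V F)))
    \<le> measure_pmf.expectation (percolation E p)
      (\<lambda>F. real k + real (card {v \<in> V. k \<le> card (cluster F {v})}))"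
    using fin(2) by (intro expectation_percolation_mono) (auto simp flip: of_nat_add)
  also have "\<dots> \<le> real k + real (card V) * q"
    using expectation_card_large_clusters[OF fin assms(2)]
    by (simp add: integrable_percolation[OF fin(2)])
  finally show ?thesis .
qed

lemma regular_graph_facts:
  assumes "regular_graph d V E"
  shows "graph V E" "finite E" "\<forall>e\<in>E. card e = 2" "degree E v \<le> d"
proof -
  show g: "graph V E" using assms by (simp add: regular_graph_def)
  then show "finite E" "\<forall>e\<in>E. card e = 2"
    using graph_finite_edges by (auto simp: graph_def)
  show "degree E v \<le> d"
  proof (cases "v \<in> V")
    case True
    then show ?thesis using assms by (simp add: regular_graph_def)
  next
    case False
    then have "{e \<in> E. v \<in> e} = {}" using g by (auto simp: graph_def)
    then show ?thesis by (metis card.empty degree_def le0)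
  qed
qed

lemma less_real_iff_floor_less:
  assumes "0 < K"
  shows "K < real c \<longleftrightarrow> Suc (nat \<lfloor>K\<rfloor>) \<le> c"
  using assms by linarith

text \<open>With \<open>k \<ge> A n^(2/3)\<close>, the bound \<open>(n/k) (6/sqrt k)\<close> is at most \<open>6/A^(3/2)\<close>.\<close>

lemma critical_largest_component:
  fixes p A :: real
  assumes "3 \<le> d" "regular_graph d V E" "0 \<le> p" "p \<le> 1 / (real d - 1)" "1 < A"
  shows "measure_pmf.prob (percolation E p)
      {F. real (card (largest_component V F)) > A * real (card V) powr (2 / 3)}
    \<le> 8 / A powr (3 / 2)"
proof -
  note G = regular_graph_facts[OF assms(2)]
  define n where "n = real (card V)"
  define K where "K = A * n powr (2 / 3)"
  define k where "k = nat \<lfloor>K\<rfloor> + 1"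
  let ?P = "measure_pmf.prob (percolation E p) {F. k \<le> card (largest_component V F)}"
  have n: "1 \<le> n"
    using G(1) by (simp add: n_def graph_def Suc_le_eq card_gt_0_iff)
  then have K: "0 < K" using assms(5) by (simp add: K_def)
  have k: "K \<le> real k" "1 \<le> k" unfolding k_def by linarith+
  have event: "{F. real (card (largest_component V F)) > K} = {F. k \<le> card (largest_component V F)}"
    using less_real_iff_floor_less K by (simp add: k_def)
  have "real k * ?P \<le> n * (6 / sqrt k)"
    unfolding n_def
    by (intro prob_largest_component_le[OF G(1)] critical_cluster_tail[OF G(2-4) assms(1,3,4) k(2)])
  then have "sqrt k * (real k * ?P) \<le> sqrt k * (n * (6 / sqrt k))"
    by (intro mult_left_mono) auto
  also have "\<dots> = 6 * n" using k(2) by simp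
  finally have "real k * sqrt k * ?P \<le> 6 * n" by (simp only: mult_ac)
  moreover have "A powr (3 / 2) * n \<le> real k * sqrt k"
  proof -
    have "A powr (3 / 2) * n = K powr (3 / 2)"
      using assms(5) n by (simp add: K_def powr_mult powr_powr)
    also have "\<dots> \<le> real k powr (3 / 2)" using k(1) K by (intro powr_mono2) auto
    also have "\<dots> = real k powr 1 * real k powr (1 / 2)"
      by (subst powr_add[symmetric]) simp
    also have "\<dots> = real k * sqrt k" using k(2) by (simp add: powr_half_sqrt)
    finally show ?thesis .
  qed
  ultimately have "A powr (3 / 2) * n * ?P \<le> 6 * n"
    using mult_right_mono[of "A powr (3 / 2) * n" "real k * sqrt k" ?P] by simp
  then have "A powr (3 / 2) * ?P \<le> 6" using n by simp
  then have "?P \<le> 6 / A powr (3 / 2)" using assms(5) by (simp add: field_simps)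
  also have "\<dots> \<le> 8 / A powr (3 / 2)" by (simp add: divide_right_mono)
  finally show ?thesis unfolding n_def[symmetric] K_def[symmetric] event .
qed

text \<open>The cut-off \<open>k\<close> near \<open>n^(2/3)\<close> balances the two terms \<open>k\<close> and \<open>n/sqrt k\<close>.\<close>

lemma supercritical_largest_component:
  fixes p \<epsilon> :: real
  assumes "3 \<le> d" "regular_graph d V E" "0 \<le> \<epsilon>" "p = (1 + \<epsilon>) / (real d - 1)" "p \<le> 1"
  shows "measure_pmf.expectation (percolation E p) (\<lambda>F. real (card (largest_component V F)))
    \<le> 32 * (real (card V) powr (2 / 3) + \<epsilon> * real (card V))"
proof -
  note G = regular_graph_facts[OF assms(2)]
  define n where "n = real (card V)"
  define K where "K = n powr (2 / 3)"
  define k where "k = nat \<lceil>K\<rceil>"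
  have p: "0 \<le> p" using assms(1,3,4) by simp
  have n: "1 \<le> n"
    using G(1) by (simp add: n_def graph_def Suc_le_eq card_gt_0_iff)
  then have K: "1 \<le> K" by (simp add: K_def ge_one_powr_ge_zero)
  have k: "K \<le> real k" "real k \<le> K + 1" "1 \<le> k" using K unfolding k_def by linarith+
  have "n / sqrt k \<le> K"
  proof -
    have "n = K * n powr (1 / 3)" using n by (simp add: K_def flip: powr_add)
    also have "n powr (1 / 3) = sqrt K"
      using n by (simp add: K_def powr_powr flip: powr_half_sqrt)
    also have "K * sqrt K \<le> K * sqrt k" using K k by simp
    finally show ?thesis using k(3) by (simp add: divide_le_eq)
  qed
  have "measure_pmf.expectation (percolation E p) (\<lambda>F. real (card (largest_component V F)))
      \<le> real k + n * (32 * \<epsilon> + 16 / sqrt k)"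
    unfolding n_def
    using assms(3-5) p k(3)
    by (intro expectation_largest_component_le[OF G(1)] supercritical_cluster_tail[OF G(2-4) assms(1)])
      auto
  also have "\<dots> = real k + 32 * (\<epsilon> * n) + 16 * (n / sqrt k)"
    by (simp add: algebra_simps)
  also have "\<dots> \<le> 32 * (K + \<epsilon> * n)"
    using \<open>n / sqrt k \<le> K\<close> k K unfolding distrib_left by linarith
  finally show ?thesis unfolding K_def n_def .
qed

text \<open>A bound for a single graph. With \<open>L = ln (n \<epsilon>\<^sup>3)\<close> and \<open>s\<close> the critical offspring variance, the
  threshold is \<open>K = 2 s (1 + \<eta>) L/\<epsilon>\<^sup>2\<close>. The likelihood ratio at \<open>K\<close> is \<open>exp (- (1 + \<eta>)(1 - \<epsilon>) L)\<close>
  or less, and half of \<open>\<eta>\<close> is given up to absorb the factor \<open>1 - \<epsilon>\<close>; the remaining factor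
  \<open>n/K^(3/2) \<le> n \<epsilon>\<^sup>3 = exp L\<close> leaves \<open>exp (- \<eta> L/2)\<close>.\<close>

lemma subcritical_largest_component:
  fixes p \<epsilon> \<eta> :: real
  assumes "3 \<le> d" "regular_graph d V E" "p = (1 - \<epsilon>) / (real d - 1)"
    and \<epsilon>: "0 < \<epsilon>" "\<epsilon> \<le> 1 / 2" "1 + \<eta> / 2 \<le> (1 + \<eta>) * (1 - \<epsilon>)" and "0 < \<eta>"
    and large: "1 \<le> ln (real (card V) * \<epsilon> ^ 3)"
  shows "measure_pmf.prob (percolation E p)
      {F. real (card (largest_component V F)) >
        (1 + \<eta>) * ((real d - 2) / (real d - 1)) * \<psi> (card V) \<epsilon>}
    \<le> 48 * (real (card V) * \<epsilon> ^ 3) powr (- (\<eta> / 2))"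
proof -
  note G = regular_graph_facts[OF assms(2)]
  define n where "n = real (card V)"
  define L where "L = ln (n * \<epsilon> ^ 3)"
  define s where "s = (real d - 2) / (real d - 1)"
  define K where "K = (1 + \<eta>) * s * \<psi> (card V) \<epsilon>"
  define k where "k = nat \<lfloor>K\<rfloor> + 1"
  define x where "x = real k * (\<epsilon>\<^sup>2 / 2 * (1 / s) * (1 - \<epsilon>))"
  let ?P = "measure_pmf.prob (percolation E p) {F. k \<le> card (largest_component V F)}"
  have n: "1 \<le> n"
    using G(1) by (simp add: n_def graph_def Suc_le_eq card_gt_0_iff)
  have L: "1 \<le> L" "exp L = n * \<epsilon> ^ 3"
    using large n \<epsilon> by (simp_all add: L_def n_def)
  have s: "1 / 2 \<le> s" using assms(1) by (simp add: s_def field_simps)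
  have K_eq: "K = 2 * s * ((1 + \<eta>) * L) / \<epsilon>\<^sup>2"
    by (simp add: K_def \<psi>_def L_def n_def)
  \<comment> \<open>Only \<open>K \<ge> 1/\<epsilon>\<^sup>2\<close> is kept from the definition of \<open>K\<close> for the polynomial factor \<open>k^(3/2)\<close>.\<close>
  have "1 * 1 \<le> (2 * s) * ((1 + \<eta>) * L)"
    using s L \<open>0 < \<eta>\<close> mult_mono[of 1 "1 + \<eta>" 1 L] by (intro mult_mono) auto
  then have K: "1 / \<epsilon>\<^sup>2 \<le> K"
    unfolding K_eq by (simp add: divide_right_mono)
  moreover have "0 < 1 / \<epsilon>\<^sup>2" using \<epsilon> by simp
  ultimately have "0 < K" by linarith
  have k: "K \<le> real k" "1 \<le> k" unfolding k_def by linarith+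
  have event: "{F. real (card (largest_component V F)) > K} = {F. k \<le> card (largest_component V F)}"
    using less_real_iff_floor_less \<open>0 < K\<close> by (simp add: k_def)
  have "real k * ?P \<le> n * (48 / sqrt k * exp (- x))"
  proof -
    have "1 / s = (real d - 1) / (real d - 2)" by (simp add: s_def)
    then show ?thesis
      unfolding n_def x_def using assms(3) \<epsilon> k(2)
      by (intro prob_largest_component_le[OF G(1)])
        (simp only: subcritical_cluster_tail[OF G(2-4) assms(1)] less_imp_le)
  qed
  then have "sqrt k * (real k * ?P) \<le> sqrt k * (n * (48 / sqrt k * exp (- x)))"
    by (intro mult_left_mono) auto
  also have "\<dots> = 48 * n * exp (- x)" using k(2) by simp
  finally have "real k * sqrt k * ?P \<le> 48 * n * exp (- x)" by (simp only: mult_ac)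
  moreover have "1 / \<epsilon> ^ 3 \<le> real k * sqrt k"
  proof -
    have "1 / \<epsilon>\<^sup>2 \<le> real k" using K k by linarith
    moreover from this have "sqrt (1 / \<epsilon>\<^sup>2) \<le> sqrt k" by (rule real_sqrt_le_mono)
    moreover have "sqrt (1 / \<epsilon>\<^sup>2) = 1 / \<epsilon>" using \<epsilon> by (simp add: real_sqrt_divide)
    ultimately have "1 / \<epsilon>\<^sup>2 * (1 / \<epsilon>) \<le> real k * sqrt k"
      using \<epsilon> by (intro mult_mono) auto
    then show ?thesis by (simp add: power2_eq_square power3_eq_cube mult.assoc)
  qed
  ultimately have "1 / \<epsilon> ^ 3 * ?P \<le> 48 * n * exp (- x)"
    using mult_right_mono[of "1 / \<epsilon> ^ 3" "real k * sqrt k" ?P] by simp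
  then have "?P \<le> 48 * (n * \<epsilon> ^ 3) * exp (- x)"
    using \<epsilon> by (simp add: field_simps)
  also have "\<dots> = 48 * exp (L - x)" by (simp add: L(2)[symmetric] exp_diff exp_minus field_simps)
  also have "\<dots> \<le> 48 * exp (- (\<eta> / 2) * L)"
  proof -
    \<comment> \<open>The variance \<open>s\<close> and \<open>\<epsilon>\<^sup>2\<close> in \<open>K\<close> cancel against the rate.\<close>
    have "(1 + \<eta> / 2) * L \<le> (1 + \<eta>) * (1 - \<epsilon>) * L"
      using \<epsilon>(3) L by (intro mult_right_mono) auto
    also have "\<dots> = K * (\<epsilon>\<^sup>2 / 2 * (1 / s) * (1 - \<epsilon>))"
      using s \<epsilon> by (simp add: K_eq field_simps)
    also have "\<dots> \<le> x"
      unfolding x_def using k(1) s \<epsilon> by (intro mult_right_mono) auto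
    finally have "L - x \<le> - (\<eta> / 2) * L" by (simp add: algebra_simps)
    then show ?thesis by simp
  qed
  also have "\<dots> = 48 * (n * \<epsilon> ^ 3) powr (- (\<eta> / 2))"
    using n \<epsilon> by (simp add: powr_def L_def)
  finally show ?thesis unfolding n_def[symmetric] s_def[symmetric] K_def[symmetric] event .
qed

lemma subcritical_largest_component_tendsto:
  fixes N :: "nat set" and V :: "nat \<Rightarrow> 'a set" and E :: "nat \<Rightarrow> 'a set set"
    and \<epsilon> p :: "nat \<Rightarrow> real" and \<eta> :: real
  assumes "3 \<le> d"
    and G: "\<And>n. n \<in> N \<Longrightarrow> regular_graph d (V n) (E n) \<and> card (V n) = n"
    and p: "\<And>n. n \<in> N \<Longrightarrow> 0 \<le> \<epsilon> n \<and> p n = (1 - \<epsilon> n) / (real d - 1)"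
    and lim0: "(\<epsilon> \<longlongrightarrow> 0) (inf sequentially (principal N))"
    and lim_top: "filterlim (\<lambda>n. \<epsilon> n * real n powr (1 / 3)) at_top (inf sequentially (principal N))"
    and "0 < \<eta>"
  shows "((\<lambda>n. measure_pmf.prob (percolation (E n) (p n))
               {F. real (card (largest_component (V n) F))
                     > (1 + \<eta>) * ((real d - 2) / (real d - 1)) * \<psi> n (\<epsilon> n)})
          \<longlongrightarrow> 0) (inf sequentially (principal N))"
proof -
  let ?F = "inf sequentially (principal N)"
  let ?P = "\<lambda>n. measure_pmf.prob (percolation (E n) (p n))
    {F. real (card (largest_component (V n) F))
      > (1 + \<eta>) * ((real d - 2) / (real d - 1)) * \<psi> n (\<epsilon> n)}"
  have N: "eventually (\<lambda>n. n \<in> N) ?F"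
    by (simp add: eventually_inf_principal)
  have cube: "filterlim (\<lambda>n. real n * \<epsilon> n ^ 3) at_top ?F"
  proof -
    have "real n * \<epsilon> n ^ 3 = (\<epsilon> n * real n powr (1 / 3)) ^ 3" for n
    proof -
      have "(real n powr (1 / 3)) ^ 3 = real n"
        by (cases "n = 0") (simp_all add: powr_powr flip: powr_realpow)
      then show ?thesis by (simp add: power_mult_distrib mult.commute)
    qed
    then show ?thesis
      using filterlim_pow_at_top[OF _ lim_top, of 3] by simp
  qed
  \<comment> \<open>The second bound on \<open>\<epsilon>\<close> is equivalent to \<open>(1 + \<eta>)(1 - \<epsilon>) \<ge> 1 + \<eta>/2\<close>.\<close>
  let ?\<gamma> = "min (1 / 2) (\<eta> / (2 * (1 + \<eta>)))"
  have "0 < ?\<gamma>" using \<open>0 < \<eta>\<close> by simp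
  then have "eventually (\<lambda>n. \<epsilon> n < ?\<gamma>) ?F"
    by (rule order_tendstoD(2)[OF lim0])
  moreover have "eventually (\<lambda>n. exp 1 \<le> real n * \<epsilon> n ^ 3) ?F"
    using cube by (simp add: filterlim_at_top)
  ultimately have "eventually (\<lambda>n. norm (?P n) \<le>
      48 * (real n * \<epsilon> n ^ 3) powr (- (\<eta> / 2))) ?F"
    using N
  proof eventually_elim
    case (elim n)
    have r: "regular_graph d (V n) (E n)" and c: "card (V n) = n"
      using G[OF elim(3)] by simp_all
    have \<epsilon>0: "0 \<le> \<epsilon> n" and pn: "p n = (1 - \<epsilon> n) / (real d - 1)"
      using p[OF elim(3)] by simp_all
    have pos: "0 < real n * \<epsilon> n ^ 3"
      using elim(2) exp_gt_zero[of "1 :: real"] by linarith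
    then have "\<epsilon> n \<noteq> 0" by auto
    with \<epsilon>0 have \<epsilon>1: "0 < \<epsilon> n" by linarith
    have large: "1 \<le> ln (real (card (V n)) * \<epsilon> n ^ 3)"
      unfolding c using elim(2) pos by (subst ln_ge_iff) auto
    have \<epsilon>2: "\<epsilon> n \<le> 1 / 2" using elim(1) by simp
    have \<epsilon>3: "1 + \<eta> / 2 \<le> (1 + \<eta>) * (1 - \<epsilon> n)"
      using elim(1) \<open>0 < \<eta>\<close> by (simp add: field_simps)
    have "?P n \<le> 48 * (real n * \<epsilon> n ^ 3) powr (- (\<eta> / 2))"
      using subcritical_largest_component[OF assms(1) r pn \<epsilon>1 \<epsilon>2 \<epsilon>3 \<open>0 < \<eta>\<close> large]
      unfolding c .
    then show ?case by (simp only: real_norm_def abs_of_nonneg[OF measure_nonneg])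
  qed
  moreover have "((\<lambda>n. 48 * (real n * \<epsilon> n ^ 3) powr (- (\<eta> / 2))) \<longlongrightarrow> 0) ?F"
    using tendsto_mult_left[OF tendsto_neg_powr[OF _ cube], of "- (\<eta> / 2)" 48] \<open>0 < \<eta>\<close>
    by simp
  ultimately show ?thesis by (rule Lim_null_comparison)
qed

theorem proposition1:
  fixes d :: nat
  assumes "d \<ge> 3"
  shows
   "(\<forall>(N :: nat set) (V :: nat \<Rightarrow> 'a set) (E :: nat \<Rightarrow> 'a set set)
       (\<epsilon> :: nat \<Rightarrow> real) (p :: nat \<Rightarrow> real) (\<eta> :: real).
       infinite N \<and>
       (\<forall>n\<in>N. regular_graph d (V n) (E n) \<and> card (V n) = n) \<and>
       (\<forall>n\<in>N. \<epsilon> n \<ge> 0 \<and> p n = (1 - \<epsilon> n) / (real d - 1) \<and> 0 < p n \<and> p n < 1) \<and>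
       (\<epsilon> \<longlongrightarrow> 0) (inf sequentially (principal N)) \<and>
       filterlim (\<lambda>n. \<epsilon> n * real n powr (1 / 3)) at_top (inf sequentially (principal N)) \<and>
       \<eta> > 0 \<longrightarrow>
       ((\<lambda>n. measure_pmf.prob (percolation (E n) (p n))
               {F. real (card (largest_component (V n) F))
                     > (1 + \<eta>) * ((real d - 2) / (real d - 1)) * \<psi> n (\<epsilon> n)})
          \<longlongrightarrow> 0) (inf sequentially (principal N)))
    \<and>
    (\<forall>(n :: nat) (V :: 'a set) (E :: 'a set set) (p :: real) (A :: real).
       regular_graph d V E \<and> card V = n \<and>
       0 < p \<and> p < 1 \<and> p \<le> 1 / (real d - 1) \<and> A > 1 \<longrightarrow>
       measure_pmf.prob (percolation E p)
         {F. real (card (largest_component V F)) > A * real n powr (2 / 3)}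
       \<le> 8 / A powr (3 / 2))
    \<and>
    (\<exists>C > 0. \<forall>(n :: nat) (V :: 'a set) (E :: 'a set set) (\<epsilon> :: real) (p :: real).
       regular_graph d V E \<and> card V = n \<and>
       \<epsilon> > 0 \<and> p = (1 + \<epsilon>) / (real d - 1) \<and> 0 < p \<and> p < 1 \<longrightarrow>
       measure_pmf.expectation (percolation E p) (\<lambda>F. real (card (largest_component V F)))
       \<le> C * (real n powr (2 / 3) + \<epsilon> * real n))"
proof (intro conjI allI impI)
  fix N :: "nat set" and V :: "nat \<Rightarrow> 'a set" and E :: "nat \<Rightarrow> 'a set set"
    and \<epsilon> p :: "nat \<Rightarrow> real" and \<eta> :: real
  assume "infinite N \<and>
       (\<forall>n\<in>N. regular_graph d (V n) (E n) \<and> card (V n) = n) \<and>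
       (\<forall>n\<in>N. \<epsilon> n \<ge> 0 \<and> p n = (1 - \<epsilon> n) / (real d - 1) \<and> 0 < p n \<and> p n < 1) \<and>
       (\<epsilon> \<longlongrightarrow> 0) (inf sequentially (principal N)) \<and>
       filterlim (\<lambda>n. \<epsilon> n * real n powr (1 / 3)) at_top (inf sequentially (principal N)) \<and>
       \<eta> > 0"
  then show "((\<lambda>n. measure_pmf.prob (percolation (E n) (p n))
               {F. real (card (largest_component (V n) F))
                     > (1 + \<eta>) * ((real d - 2) / (real d - 1)) * \<psi> n (\<epsilon> n)})
          \<longlongrightarrow> 0) (inf sequentially (principal N))"
    by (intro subcritical_largest_component_tendsto assms) simp_all
next
  fix n :: nat and V :: "'a set" and E :: "'a set set" and p A :: real
  assume "regular_graph d V E \<and> card V = n \<and> 0 < p \<and> p < 1 \<and> p \<le> 1 / (real d - 1) \<and> A > 1"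
  then show "measure_pmf.prob (percolation E p)
         {F. real (card (largest_component V F)) > A * real n powr (2 / 3)} \<le> 8 / A powr (3 / 2)"
    using critical_largest_component[OF assms, of V E p A] by auto
next
  show "\<exists>C > 0. \<forall>(n :: nat) (V :: 'a set) (E :: 'a set set) (\<epsilon> :: real) (p :: real).
       regular_graph d V E \<and> card V = n \<and>
       \<epsilon> > 0 \<and> p = (1 + \<epsilon>) / (real d - 1) \<and> 0 < p \<and> p < 1 \<longrightarrow>
       measure_pmf.expectation (percolation E p) (\<lambda>F. real (card (largest_component V F)))
       \<le> C * (real n powr (2 / 3) + \<epsilon> * real n)"
    proof (intro exI[of _ 32] conjI allI impI)
    fix n :: nat and V :: "'a set" and E :: "'a set set" and \<epsilon> p :: real
    assume "regular_graph d V E \<and> card V = n \<and>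
       \<epsilon> > 0 \<and> p = (1 + \<epsilon>) / (real d - 1) \<and> 0 < p \<and> p < 1"
    then show "measure_pmf.expectation (percolation E p) (\<lambda>F. real (card (largest_component V F)))
       \<le> 32 * (real n powr (2 / 3) + \<epsilon> * real n)"
      using supercritical_largest_component[OF assms, of V E \<epsilon> p] by simp
  qed simp
qed

end
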